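(* Let $d\ge 1$, let $A$ be a finite alphabet and let $F:A^{\mathbb{Z}^d}\to A^{\mathbb{Z}^d}$ be a cellular automaton. Then $F$ has no topological irrational eigenvalue; that is, if $\alpha\in\mathbb{R}$ and $g:A^{\mathbb{Z}^d}\to\mathbb{C}$ is a continuous function, not identically zero, with $g\circ F=e^{2\pi i\alpha}g$, then $\alpha$ is rational.
   Context: $A^{\mathbb{Z}^d}$ carries the product topology ($A$ discrete). A cellular automaton is a map $F:A^{\mathbb{Z}^d}\to A^{\mathbb{Z}^d}$ of the form $F(x)_{m}=f(x_{m+K})$ for all $m\in\mathbb{Z}^d$, with $K\subset\mathbb{Z}^d$ finite and $f:A^{K}\to A$. *)

theory Defs
  imports "HOL-Analysis.Analysis"
begin

type_synonym ('a, 'd) config = "(int ^ 'd) \<Rightarrow> 'a"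

definition config_topology :: "('a, 'd::finite) config topology" where
  "config_topology = product_topology (\<lambda>_. discrete_topology UNIV) UNIV"

text \<open>The local rule \<open>f\<close> only ever receives a pattern \<open>x\<^bsub>m + K\<^esub>\<close>, i.e. the function
  \<open>k \<mapsto> x (m + k)\<close> on \<open>K\<close>, encoded as an element of
  \<open>K \<rightarrow>\<^sub>E UNIV\<close> (constantly undefined outside \<open>K\<close>).\<close>

definition cellular_automaton ::
    "(('a, 'd::finite) config \<Rightarrow> ('a, 'd) config) \<Rightarrow> bool" where
  "cellular_automaton F \<longleftrightarrow>
     (\<exists>(K :: (int ^ 'd) set) (f :: ((int ^ 'd) \<Rightarrow> 'a) \<Rightarrow> 'a).
        finite K \<and> (\<forall>x m. F x m = f (\<lambda>k\<in>K. x (m + k))))"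

end

theory Submission imports Defs begin

text \<open>
  Spatially periodic configurations rule out irrational eigenvalues. Those with a fixed period
  in every coordinate direction form a finite set, because the alphabet is finite and a
  fundamental domain of the period lattice is finite (\<open>finite_periodic_configs\<close>), and a
  cellular automaton maps this set into itself, because it commutes with translations
  (\<open>cellular_automaton_periodic\<close>). So the forward orbit of a periodic configuration
  \<open>y\<close> repeats: \<open>F\<^sup>i y = F\<^sup>j y\<close> with \<open>i < j\<close>. Applying an eigenfunction \<open>g\<close> with eigenvalue
  \<open>c = exp (2 \<pi> \<i> \<alpha>)\<close> gives \<open>c\<^sup>i g y = c\<^sup>j g y\<close>, and if \<open>g y \<noteq> 0\<close> then \<open>c\<close> is a root of unity,
  which makes \<open>\<alpha>\<close> rational.

  Continuity of \<open>g\<close> serves to find such a \<open>y\<close>: the set where \<open>g\<close> does not vanish is open and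
  nonempty, and periodic configurations are dense (\<open>periodic_configs_dense\<close>), since any finite
  pattern fits into a sufficiently large box, which then tiles the lattice.
\<close>

text \<open>For \<open>n > 0\<close>, reduction into the box \<open>{0..<n}\<^sup>d\<close>, the fundamental domain of \<open>n\<int>\<^sup>d\<close>. Periodicity is
  expressed as invariance under this reduction, so that a periodic configuration is
  visibly determined by its values on the box.\<close>

definition vec_mod :: "int \<Rightarrow> int ^ 'd \<Rightarrow> int ^ 'd" where
  "vec_mod n v = (\<chi> i. v $ i mod n)"

definition periodic_configs :: "int \<Rightarrow> ('a, 'd::finite) config set" where
  "periodic_configs n = {y. \<forall>m. y (vec_mod n m) = y m}"

lemma vec_mod_idem: "vec_mod n (vec_mod n v) = vec_mod n v"
  by (simp add: vec_mod_def)

lemma vec_mod_add_left: "vec_mod n (vec_mod n v + w) = vec_mod n (v + w)"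
  by (simp add: vec_mod_def vec_eq_iff mod_simps)

lemma finite_range_vec_mod:
  assumes "n > 0"
  shows "finite (range (vec_mod n :: int ^ 'd::finite \<Rightarrow> _))"
proof (rule finite_subset)
  show "range (vec_mod n :: int ^ 'd \<Rightarrow> _) \<subseteq> vec_lambda ` (\<Pi>\<^sub>E i\<in>UNIV. {0..<n})"
    using assms by (auto simp: vec_mod_def)
qed (intro finite_imageI finite_PiE, auto)

lemma finite_periodic_configs:
  assumes "n > 0"
  shows "finite (periodic_configs n :: ('a::finite, 'd::finite) config set)"
proof -
  let ?B = "range (vec_mod n :: int ^ 'd \<Rightarrow> _)"
  let ?tile = "\<lambda>z :: ('a, 'd) config. \<lambda>m. z (vec_mod n m)"
  have "periodic_configs n \<subseteq> ?tile ` (\<Pi>\<^sub>E i\<in>?B. UNIV)"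
  proof
    fix y :: "('a, 'd) config"
    assume "y \<in> periodic_configs n"
    then have "y = ?tile (restrict y ?B)"
      by (simp add: periodic_configs_def fun_eq_iff)
    then show "y \<in> ?tile ` (\<Pi>\<^sub>E i\<in>?B. UNIV)"
      by (intro image_eqI[where x = "restrict y ?B"]) simp_all
  qed
  then show ?thesis
    by (rule finite_subset) (simp add: finite_PiE finite_range_vec_mod[OF assms])
qed

lemma cellular_automaton_periodic:
  assumes "cellular_automaton F" and y: "y \<in> periodic_configs n"
  shows "F y \<in> periodic_configs n"
proof -
  obtain K f where F: "\<And>x m. F x m = f (\<lambda>k\<in>K. x (m + k))"
    using assms(1) unfolding cellular_automaton_def by blast
  have "y (vec_mod n m + k) = y (m + k)" for m k
    using y by (metis (mono_tags, lifting) periodic_configs_def mem_Collect_eq vec_mod_add_left)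
  then show ?thesis
    by (simp add: periodic_configs_def F)
qed

text \<open>A finite pattern that lies in the cube \<open>{-N..N}\<^sup>d\<close> can be repeated with period \<open>2 N + 1\<close>,
  because no two of its sites are congruent.\<close>

lemma inj_on_vec_mod_finite:
  fixes S :: "(int ^ 'd::finite) set"
  assumes "finite S"
  obtains n where "n > 0" "inj_on (vec_mod n) S"
proof -
  define C where "C = (\<lambda>(v :: int ^ 'd, i). \<bar>v $ i\<bar>) ` (S \<times> UNIV)"
  define N where "N = Max (insert 0 C)"
  have fin: "finite (insert 0 C)"
    using assms by (simp add: C_def)
  have "N \<ge> 0"
    using fin by (simp add: N_def)
  have bound: "\<bar>v $ i\<bar> \<le> N" if "v \<in> S" for v i
    unfolding N_def using that by (intro Max_ge fin) (force simp: C_def)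
  have "inj_on (vec_mod (2 * N + 1)) S"
  proof (rule inj_onI)
    fix v w assume v: "v \<in> S" and w: "w \<in> S"
      and eq: "vec_mod (2 * N + 1) v = vec_mod (2 * N + 1) w"
    have "v $ i = w $ i" for i
    proof -
      have "2 * N + 1 dvd v $ i - w $ i"
        using eq by (simp add: vec_mod_def vec_eq_iff mod_eq_dvd_iff)
      moreover have "\<bar>v $ i - w $ i\<bar> < 2 * N + 1"
        using bound[OF v, of i] bound[OF w, of i] by linarith
      ultimately show ?thesis
        using dvd_imp_le_int[of "v $ i - w $ i" "2 * N + 1"] by linarith
    qed
    then show "v = w" by (simp add: vec_eq_iff)
  qed
  with \<open>N \<ge> 0\<close> show thesis by (intro that[of "2 * N + 1"]) auto
qed

lemma periodic_configs_dense:
  fixes U :: "('a, 'd::finite) config set"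
  assumes "openin config_topology U" and "x \<in> U"
  obtains n y where "n > 0" "y \<in> periodic_configs n" "y \<in> U"
proof -
  obtain V where fin: "finite {m. V m \<noteq> UNIV}" and xV: "\<And>m. x m \<in> V m"
    and sub: "Pi\<^sub>E UNIV V \<subseteq> U"
    using assms by (auto simp: config_topology_def openin_product_topology_alt PiE_iff)
  define S where "S = {m. V m \<noteq> UNIV}"
  obtain n where n: "n > 0" and inj: "inj_on (vec_mod n) S"
    using inj_on_vec_mod_finite fin S_def by metis
  \<comment> \<open>Off the translates of \<open>S\<close> by the period lattice, \<open>inv_into\<close> returns an unspecified
    site; any value of \<open>y\<close> will do there.\<close>
  define y where "y m = x (inv_into S (vec_mod n) (vec_mod n m))" for m
  have "y \<in> periodic_configs n"
    by (simp add: periodic_configs_def y_def vec_mod_idem)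
  moreover have "y m \<in> V m" for m
  proof (cases "m \<in> S")
    case True
    then show ?thesis by (simp add: y_def inv_into_f_f[OF inj] xV)
  next
    case False
    then show ?thesis by (simp add: S_def)
  qed
  ultimately show thesis
    using that n sub by blast
qed

lemma orbit_repeats_in_finite_set:
  fixes F :: "'b \<Rightarrow> 'b"
  assumes "finite P" "\<And>z. z \<in> P \<Longrightarrow> F z \<in> P" "y \<in> P"
  obtains i j where "i < j" "(F ^^ i) y = (F ^^ j) y"
proof -
  have "(F ^^ k) y \<in> P" for k
    by (induction k) (use assms in auto)
  then have "finite (range (\<lambda>k. (F ^^ k) y))"
    using assms(1) by (meson finite_subset image_subsetI)
  then have "\<not> inj (\<lambda>k. (F ^^ k) y)"
    using finite_imageD infinite_UNIV_nat by blast
  then show thesis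
    unfolding inj_on_def using that by (metis linorder_neqE_nat)
qed

lemma rational_if_root_of_unity:
  assumes "exp (2 * of_real pi * \<i> * of_real \<alpha>) ^ p = (1 :: complex)" and "p > 0"
  shows "\<alpha> \<in> \<rat>"
proof -
  have "exp (of_nat p * (2 * of_real pi * \<i> * of_real \<alpha>)) = (1 :: complex)"
    using assms(1) by (simp only: exp_of_nat_mult)
  then obtain k :: int where "real p * (2 * pi * \<alpha>) = of_int (2 * k) * pi"
    by (auto simp: exp_eq_1)
  then have "\<alpha> = of_int k / of_nat p"
    using \<open>p > 0\<close> by (simp add: field_simps)
  then show ?thesis by simp
qed

theorem proposition12:
  fixes F :: "('a::finite, 'd::finite) config \<Rightarrow> ('a, 'd) config"
    and g :: "('a, 'd) config \<Rightarrow> complex"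
    and \<alpha> :: real
  assumes "cellular_automaton F"
    and "continuous_map config_topology euclidean g"
    and "\<exists>x. g x \<noteq> 0"
    and "g \<circ> F = (\<lambda>x. exp (2 * of_real pi * \<i> * of_real \<alpha>) * g x)"
  shows "\<alpha> \<in> \<rat>"
proof -
  define c :: complex where "c = exp (2 * of_real pi * \<i> * of_real \<alpha>)"
  have "openin config_topology {x \<in> topspace config_topology. g x \<in> - {0}}"
    using assms(2) by (rule openin_continuous_map_preimage) auto
  then have "openin config_topology {x. g x \<noteq> 0}"
    by (simp add: config_topology_def)
  moreover obtain x where "x \<in> {x. g x \<noteq> 0}"
    using assms(3) by blast
  ultimately obtain n y where n: "n > 0" and y: "y \<in> periodic_configs n"
      and "y \<in> {x. g x \<noteq> 0}"
    by (rule periodic_configs_dense)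
  then have gy: "g y \<noteq> 0" by simp
  obtain i j where "i < j" and ij: "(F ^^ i) y = (F ^^ j) y"
    by (rule orbit_repeats_in_finite_set[OF finite_periodic_configs[OF n]
        cellular_automaton_periodic[OF assms(1)] y])
  have "g (F z) = c * g z" for z
    using assms(4) by (simp add: fun_eq_iff c_def)
  then have "g ((F ^^ k) y) = c ^ k * g y" for k
    by (induction k) auto
  then have "c ^ i = c ^ j"
    using gy ij by (metis mult_right_cancel)
  also have "c ^ j = c ^ i * c ^ (j - i)"
    using \<open>i < j\<close> by (simp flip: power_add)
  finally have "c ^ (j - i) = 1"
    by (simp add: c_def)
  then show ?thesis
    using rational_if_root_of_unity[of \<alpha> "j - i"] \<open>i < j\<close> by (simp add: c_def)
qed

end
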